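(* Let $n\ge 1$, let $\alpha_1,\dots,\alpha_n\in\mathbb{K}$ and $A_1,\dots,A_n\in B(H)$. Let $F$ be any one of the following three quantities: \begin{itemize} \item[(F1)] $\max_{1\le i\le n}|\alpha_i|^2\,\sum_{i=1}^n\|A_i\|^2$; \item[(F2)] $\left(\sum_{i=1}^n|\alpha_i|^{2p}\right)^{1/p}\left(\sum_{i=1}^n\|A_i\|^{2q}\right)^{1/q}$, where $p>1$ and $\frac1p+\frac1q=1$; \item[(F3)] $\sum_{i=1}^n|\alpha_i|^2\,\max_{1\le i\le n}\|A_i\|^2$; \end{itemize} and let $G$ be any one of the following three quantities: \begin{itemize} \item[(G1)] $\max_{1\le i\ne j\le n}\{|\alpha_i||\alpha_j|\}\,\sum_{1\le i\ne j\le n}\|A_iA_j^*\|$; \item[(G2)] $\left[\left(\sum_{i=1}^n|\alpha_i|^{r}\right)^2-\sum_{i=1}^n|\alpha_i|^{2r}\right]^{1/r}\left(\sum_{1\le i\ne j\le n}\|A_iA_j^*\|^s\right)^{1/s}$, where $r>1$ and $\frac1r+\frac1s=1$; \item[(G3)] $\left[\left(\sum_{i=1}^n|\alpha_i|\right)^2-\sum_{i=1}^n|\alpha_i|^2\right]\max_{1\le i\ne j\le n}\|A_iA_j^*\|$. \end{itemize} Then, for each of the nine possible choices of the pair $(F,G)$, $$\left\|\sum_{i=1}^n\alpha_iA_i\right\|^2\le F+G.$$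
   Context: $H$ is a real or complex Hilbert space with scalar field $\mathbb{K}\in\{\mathbb{R},\mathbb{C}\}$; $B(H)$ is the Banach algebra of bounded linear operators $H\to H$ with the operator norm $\|\cdot\|$; $A^*$ denotes the adjoint of $A$. Sums and maxima over $1\le i\ne j\le n$ run over all ordered pairs $(i,j)\in\{1,\dots,n\}^2$ with $i\neq j$; if $n=1$, such sums and maxima are taken to be $0$. *)

theory Defs
  imports "HOL-Analysis.Analysis"
begin

text \<open>
  The scalar field. Up to isometric isomorphism the only \<^class>\<open>real_normed_field\<close>s are the reals
  and the complex numbers, and the axioms force \<open>kconj\<close> to be the usual
  conjugation, so this class has exactly the two intended models.
\<close>

class rc_field = real_normed_field +
  fixes kconj :: "'a \<Rightarrow> 'a"
  assumes kconj_add: "kconj (x + y) = kconj x + kconj y"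
    and mult_kconj: "x * kconj x = (norm x)\<^sup>2 *\<^sub>R 1"

instantiation real :: rc_field
begin
definition kconj_real :: "real \<Rightarrow> real" where "kconj_real x = x"
instance by standard (simp_all add: kconj_real_def power2_eq_square)
end

instantiation complex :: rc_field
begin
definition kconj_complex :: "complex \<Rightarrow> complex" where "kconj_complex = cnj"
instance
proof
  fix x y :: complex
  show "kconj (x + y) = kconj x + kconj y" by (simp add: kconj_complex_def)
  show "x * kconj x = (norm x)\<^sup>2 *\<^sub>R 1"
    by (simp only: kconj_complex_def scaleR_conv_of_real complex_norm_square mult_1_right)
qed
end

text \<open>
  Completeness, and the underlying real normed space, come from the class \<^class>\<open>banach\<close>;
  \<open>ip_self\<close> says that its norm is the one induced by the inner product (and hence that the
  inner product is positive definite). The inner product is linear in the first argument.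
\<close>

locale hilbert_space = vector_space smul
  for smul :: "'k::rc_field \<Rightarrow> 'h::banach \<Rightarrow> 'h" +
  fixes ip :: "'h \<Rightarrow> 'h \<Rightarrow> 'k"
  assumes scale_of_real: "smul (of_real r) x = r *\<^sub>R x"
    and ip_add_left: "ip (x + y) z = ip x z + ip y z"
    and ip_scale_left: "ip (smul c x) y = c * ip x y"
    and ip_conj_sym: "ip y x = kconj (ip x y)"
    and ip_self: "ip x x = of_real ((norm x)\<^sup>2)"

definition bounded_operators :: "('k::rc_field \<Rightarrow> 'h::real_normed_vector \<Rightarrow> 'h) \<Rightarrow> ('h \<Rightarrow> 'h) set" where
  "bounded_operators smul = {A. Vector_Spaces.linear smul smul A \<and> bounded_linear A}"

text \<open>
  The analogue of \<^const>\<open>adjoint\<close> for an arbitrary inner product. On a Hilbert space the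
  defining property has exactly one solution when \<open>A\<close> is bounded, and that solution is bounded.
\<close>

definition hilbert_adjoint :: "('h \<Rightarrow> 'h \<Rightarrow> 'k) \<Rightarrow> ('h \<Rightarrow> 'h) \<Rightarrow> 'h \<Rightarrow> 'h" where
  "hilbert_adjoint ip A = (SOME B. \<forall>x y. ip (A x) y = ip x (B y))"

definition off_diag :: "nat \<Rightarrow> (nat \<times> nat) set" where
  "off_diag n = {(i, j). i \<in> {1..n} \<and> j \<in> {1..n} \<and> i \<noteq> j}"

text \<open>Maximum over a finite index set, with the convention that the empty maximum is 0.\<close>

definition max_over :: "'i set \<Rightarrow> ('i \<Rightarrow> real) \<Rightarrow> real" where
  "max_over I f = (if I = {} then 0 else Max (f ` I))"

text \<open>
  Every real Hilbert space of the library is an instance, with its own \<^const>\<open>adjoint\<close>, and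
  the complex case is inhabited.
\<close>

lemma hilbert_space_real:
  "hilbert_space (scaleR :: real \<Rightarrow> 'h \<Rightarrow> 'h) (inner :: 'h::{real_inner, banach} \<Rightarrow> 'h \<Rightarrow> real)"
proof unfold_locales
  fix x y z :: 'h and r c :: real
  show "of_real r *\<^sub>R x = r *\<^sub>R x" by simp
  show "inner (x + y) z = inner x z + inner y z" by (rule inner_add_left)
  show "inner (c *\<^sub>R x) y = c * inner x y" by simp
  show "inner y x = kconj (inner x y)" by (simp only: kconj_real_def inner_commute)
  show "inner x x = of_real ((norm x)\<^sup>2)" by (simp add: dot_square_norm)
qed

lemma hilbert_adjoint_real: "hilbert_adjoint inner = adjoint"
  by (rule ext) (simp only: hilbert_adjoint_def adjoint_def)

lemma hilbert_space_complex:
  "hilbert_space ((*) :: complex \<Rightarrow> complex \<Rightarrow> complex) (\<lambda>x y. x * cnj y)"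
proof unfold_locales
  fix x y z c :: complex and r :: real
  show "of_real r * x = r *\<^sub>R x" by (simp only: scaleR_conv_of_real)
  show "(x + y) * cnj z = x * cnj z + y * cnj z" by (rule distrib_right)
  show "c * x * cnj y = c * (x * cnj y)" by (rule mult.assoc)
  show "y * cnj x = kconj (x * cnj y)" by (simp add: kconj_complex_def)
  show "x * cnj x = of_real ((norm x)\<^sup>2)" by (simp only: complex_norm_square)
qed

end

theory Submission
  imports Defs
begin

text \<open>
  Write \<open>T = \<Sum>\<^sub>i \<alpha>\<^sub>i A\<^sub>i\<close>. The identity \<open>\<parallel>T\<parallel>\<^sup>2 = \<parallel>T T\<^sup>*\<parallel>\<close> turns the square of the norm into
  the norm of a double sum, \<open>T T\<^sup>* = \<Sum>\<^sub>i \<Sum>\<^sub>j \<alpha>\<^sub>i \<alpha>\<^sub>j\<^sup>* A\<^sub>i A\<^sub>j\<^sup>*\<close>, and the triangle inequality gives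
  \<open>\<parallel>T\<parallel>\<^sup>2 \<le> \<Sum>\<^sub>i \<Sum>\<^sub>j \<bar>\<alpha>\<^sub>i\<bar> \<bar>\<alpha>\<^sub>j\<bar> \<parallel>A\<^sub>i A\<^sub>j\<^sup>*\<parallel>\<close> (lemma \<open>onorm_sum_squared_le\<close>). The diagonal terms satisfy
  \<open>\<parallel>A\<^sub>i A\<^sub>i\<^sup>*\<parallel> \<le> \<parallel>A\<^sub>i\<parallel>\<^sup>2\<close>.

  What remains are two unrelated estimates of a sum of products by Hoelder's inequality, with
  the exponents \<open>(\<infinity>, 1)\<close>, \<open>(p, q)\<close> or \<open>(1, \<infinity>)\<close> (lemma \<open>Hoelder_inequality_sum_cases\<close>). Applied to
  \<open>\<bar>\<alpha>\<^sub>i\<bar>\<^sup>2\<close> and \<open>\<parallel>A\<^sub>i\<parallel>\<^sup>2\<close> on the diagonal, they give the three choices of \<open>F\<close>; applied to \<open>\<bar>\<alpha>\<^sub>i\<bar> \<bar>\<alpha>\<^sub>j\<bar>\<close>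
  and \<open>\<parallel>A\<^sub>i A\<^sub>j\<^sup>*\<parallel>\<close> off the diagonal, they give the three choices of \<open>G\<close>. The differences of sums
  in \<open>G\<close> arise because \<open>\<Sum>\<^bsub>i \<noteq> j\<^esub> x\<^sub>i x\<^sub>j = (\<Sum>\<^sub>i x\<^sub>i)\<^sup>2 - \<Sum>\<^sub>i x\<^sub>i\<^sup>2\<close>, used with \<open>x\<^sub>i = \<bar>\<alpha>\<^sub>i\<bar>\<^sup>r\<close> and \<open>x\<^sub>i = \<bar>\<alpha>\<^sub>i\<bar>\<close>.

  The adjoint is a choice of a solution of \<open>\<langle>A x, y\<rangle> = \<langle>x, B y\<rangle>\<close>, so all of this depends on such a
  solution existing. That follows from the Riesz representation theorem, which in turn comes
  from completeness through the element of least norm of a closed convex set.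
\<close>

section \<open>Conjugation in the scalar field\<close>

lemma kconj_zero [simp]: "kconj (0::'k::rc_field) = 0"
  using kconj_add[of "0::'k" 0] by simp

text \<open>
  The product \<open>x * kconj x\<close> determines \<open>kconj x\<close> for \<open>x \<noteq> 0\<close>, and additivity does so at \<open>0\<close>. All
  algebraic laws of conjugation are read off from this formula.
\<close>

lemma kconj_eq_divide:
  fixes x :: "'k::rc_field"
  shows "kconj x = of_real ((norm x)\<^sup>2) / x"
proof (cases "x = 0")
  case False
  then show ?thesis
    using mult_kconj[of x] by (simp add: scaleR_conv_of_real field_simps)
qed simp

lemma norm_kconj [simp]: "norm (kconj (x::'k::rc_field)) = norm x"
proof (cases "x = 0")
  case False
  then show ?thesis
    by (simp add: kconj_eq_divide norm_divide power2_eq_square del: of_real_power of_real_mult)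
qed simp

lemma kconj_mult: "kconj (x * y) = kconj x * kconj (y::'k::rc_field)"
  by (simp add: kconj_eq_divide norm_mult power_mult_distrib)

lemma kconj_of_real [simp]: "kconj (of_real r :: 'k::rc_field) = of_real r"
  by (cases "r = 0") (simp_all add: kconj_eq_divide power2_eq_square)

lemma mult_kconj_of_real: "x * kconj x = of_real ((norm (x::'k::rc_field))\<^sup>2)"
  by (simp only: mult_kconj scaleR_conv_of_real mult_1_right)

lemma kconj_kconj [simp]: "kconj (kconj x) = (x::'k::rc_field)"
  unfolding kconj_eq_divide[of "kconj x"] norm_kconj by (simp add: kconj_eq_divide[of x])

section \<open>Inner product geometry\<close>

context hilbert_space
begin

lemma scale_of_real_scaleR: "r *\<^sub>R x = smul (of_real r) x"
  by (simp add: scale_of_real)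

lemma ip_add_right: "ip x (y + z) = ip x y + ip x z"
  by (metis ip_conj_sym ip_add_left kconj_add)

lemma ip_scale_right: "ip x (smul c y) = kconj c * ip x y"
  by (metis ip_conj_sym ip_scale_left kconj_mult)

lemma ip_scaleR_right: "ip x (r *\<^sub>R y) = of_real r * ip x y"
  by (simp add: scale_of_real_scaleR ip_scale_right)

lemma ip_zero_left [simp]: "ip 0 y = 0"
  using ip_add_left[of 0 0 y] by simp

lemma ip_zero_right [simp]: "ip x 0 = 0"
  using ip_add_right[of x 0 0] by simp

lemma ip_minus_left: "ip (- x) y = - ip x y"
  using ip_add_left[of x "- x" y] by (simp add: eq_neg_iff_add_eq_0 add.commute)

lemma ip_minus_right: "ip x (- y) = - ip x y"
  using ip_add_right[of x y "- y"] by (simp add: eq_neg_iff_add_eq_0 add.commute)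

lemma ip_diff_left: "ip (x - y) z = ip x z - ip y z"
  using ip_add_left[of x "- y" z] by (simp add: ip_minus_left)

lemma ip_diff_right: "ip x (y - z) = ip x y - ip x z"
  using ip_add_right[of x y "- z"] by (simp add: ip_minus_right)

lemma ip_sum_left: "ip (\<Sum>i\<in>I. f i) y = (\<Sum>i\<in>I. ip (f i) y)"
  by (induction I rule: infinite_finite_induct) (simp_all add: ip_add_left)

lemma ip_sum_right: "ip x (\<Sum>i\<in>I. f i) = (\<Sum>i\<in>I. ip x (f i))"
  by (induction I rule: infinite_finite_induct) (simp_all add: ip_add_right)

lemma norm_smul: "norm (smul c x) = norm c * norm x"
proof -
  have "(of_real ((norm (smul c x))\<^sup>2) :: 'k) = (c * kconj c) * ip x x"
    by (simp only: ip_self[symmetric] ip_scale_left ip_scale_right) (simp add: mult_ac)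
  also have "\<dots> = of_real ((norm c * norm x)\<^sup>2)"
    by (simp add: mult_kconj_of_real ip_self power_mult_distrib)
  finally have "(norm (smul c x))\<^sup>2 = (norm c * norm x)\<^sup>2"
    by (simp only: of_real_eq_iff)
  then show ?thesis
    by simp
qed

lemma bounded_linear_smul: "bounded_linear (smul c)"
  by (rule bounded_linear_intro[where K = "norm c"])
    (simp_all add: scale_right_distrib scale_of_real_scaleR scale_left_commute norm_smul mult.commute)

lemma ip_eqI:
  assumes "\<And>x. ip x u = ip x v"
  shows "u = v"
proof -
  have "ip (u - v) (u - v) = 0"
    by (simp add: ip_diff_right assms)
  then show ?thesis
    by (simp add: ip_self)
qed

text \<open>
  The squared distance from \<open>x\<close> to its orthogonal projection on the line through \<open>y\<close>. Being
  nonnegative it gives the Cauchy--Schwarz inequality; when subtracting a multiple of \<open>y\<close>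
  cannot make \<open>x\<close> shorter, it gives the orthogonality of \<open>x\<close> and \<open>y\<close>.
\<close>

lemma norm_diff_projection:
  assumes "y \<noteq> 0"
  shows "(norm (x - smul (ip x y / of_real ((norm y)\<^sup>2)) y))\<^sup>2
    = (norm x)\<^sup>2 - (norm (ip x y))\<^sup>2 / (norm y)\<^sup>2"
proof -
  define N where "N = (of_real ((norm y)\<^sup>2) :: 'k)"
  define c where "c = ip x y / N"
  have N: "N \<noteq> 0" "ip y y = N" "kconj N = N"
    using assms by (simp_all add: N_def ip_self flip: of_real_power)
  have yx: "ip y x = kconj (ip x y)"
    by (rule ip_conj_sym)
  have "ip x y = c * N"
    using N by (simp add: c_def)
  then have kc: "kconj (ip x y) = kconj c * N"
    using N by (simp add: kconj_mult)
  have "ip (x - smul c y) (x - smul c y) = ip x x - c * ip y x - kconj c * (ip x y - c * N)"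
    by (simp add: ip_diff_left ip_diff_right ip_scale_left ip_scale_right N algebra_simps)
  also have "\<dots> = ip x x - ip x y * kconj (ip x y) / N"
    using N by (simp add: yx c_def)
  also have "\<dots> = of_real ((norm x)\<^sup>2 - (norm (ip x y))\<^sup>2 / (norm y)\<^sup>2)"
    by (simp add: ip_self N_def mult_kconj_of_real)
  finally show ?thesis
    unfolding c_def N_def ip_self of_real_eq_iff .
qed

lemma ip_Cauchy_Schwarz: "norm (ip x y) \<le> norm x * norm y"
proof (cases "y = 0")
  case False
  have "0 \<le> (norm x)\<^sup>2 - (norm (ip x y))\<^sup>2 / (norm y)\<^sup>2"
    by (simp only: norm_diff_projection[OF False, symmetric]) simp
  then have "(norm (ip x y))\<^sup>2 \<le> (norm x * norm y)\<^sup>2"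
    using False by (simp add: field_simps power_mult_distrib)
  then show ?thesis
    by (rule power2_le_imp_le) simp
qed simp

lemma parallelogram_law:
  fixes x y :: 'h
  shows "(norm (x + y))\<^sup>2 + (norm (x - y))\<^sup>2 = 2 * (norm x)\<^sup>2 + 2 * (norm y)\<^sup>2"
proof -
  have "ip (x + y) (x + y) + ip (x - y) (x - y) = 2 * ip x x + 2 * ip y y"
    by (simp add: ip_add_left ip_add_right ip_diff_left ip_diff_right)
  then have "(of_real ((norm (x + y))\<^sup>2 + (norm (x - y))\<^sup>2) :: 'k)
      = of_real (2 * (norm x)\<^sup>2 + 2 * (norm y)\<^sup>2)"
    by (simp add: ip_self)
  then show ?thesis
    by (simp only: of_real_eq_iff)
qed

section \<open>Riesz representation and the adjoint\<close>

text \<open>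
  A sequence in \<open>C\<close> whose norms approach the infimum is a Cauchy sequence: midpoints stay in \<open>C\<close>,
  so by the parallelogram law two nearly shortest elements are close to each other.
\<close>

lemma convex_closed_min_norm:
  fixes C :: "'h set"
  assumes "closed C" "convex C" "C \<noteq> {}"
  obtains z where "z \<in> C" "\<And>x. x \<in> C \<Longrightarrow> norm z \<le> norm x"
proof -
  define D where "D = (INF x\<in>C. (norm x)\<^sup>2)"
  have bdd: "bdd_below ((\<lambda>x. (norm x)\<^sup>2) ` C)"
    by (rule bdd_belowI[where m = 0]) auto
  have D_le: "D \<le> (norm x)\<^sup>2" if "x \<in> C" for x
    unfolding D_def by (rule cINF_lower[OF bdd that])
  have "\<exists>x\<in>C. (norm x)\<^sup>2 < D + inverse (real (Suc k))" for k
  proof -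
    have "D < D + inverse (real (Suc k))"
      by simp
    then show ?thesis
      using cINF_less_iff[OF assms(3) bdd] unfolding D_def by blast
  qed
  then obtain u where uC: "\<And>k. u k \<in> C"
    and u_less: "\<And>k. (norm (u k))\<^sup>2 < D + inverse (real (Suc k))"
    by metis
  have "Cauchy u"
  proof (rule metric_CauchyI)
    fix e :: real
    assume e: "e > 0"
    then obtain N where N: "inverse (real (Suc N)) < e\<^sup>2 / 4"
      using reals_Archimedean[of "e\<^sup>2 / 4"] by auto
    have "dist (u k) (u l) < e" if "k \<ge> N" "l \<ge> N" for k l
    proof -
      have "(1/2) *\<^sub>R u k + (1/2) *\<^sub>R u l \<in> C"
        using uC by (intro convexD[OF assms(2)]) auto
      then have "(1/2) *\<^sub>R (u k + u l) \<in> C"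
        by (simp add: scaleR_add_right)
      from D_le[OF this] have "4 * D \<le> (norm (u k + u l))\<^sup>2"
        by (simp add: power_mult_distrib power2_eq_square)
      moreover have "inverse (real (Suc k)) \<le> inverse (real (Suc N))"
        "inverse (real (Suc l)) \<le> inverse (real (Suc N))"
        using that by (simp_all add: le_imp_inverse_le)
      ultimately have "(norm (u k - u l))\<^sup>2 < e\<^sup>2"
        using parallelogram_law[of "u k" "u l"] u_less[of k] u_less[of l] N by linarith
      then show ?thesis
        using e by (simp add: dist_norm power2_less_imp_less)
    qed
    then show "\<exists>M. \<forall>m\<ge>M. \<forall>n\<ge>M. dist (u m) (u n) < e"
      by blast
  qed
  then obtain z where lim: "u \<longlonglongrightarrow> z"
    using Cauchy_convergent convergent_def by blast
  have "z \<in> C"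
    using closed_sequentially[OF assms(1) _ lim] uC by blast
  have "(norm z)\<^sup>2 \<le> D + 0"
  proof (rule LIMSEQ_le)
    show "(\<lambda>k. (norm (u k))\<^sup>2) \<longlonglongrightarrow> (norm z)\<^sup>2"
      by (intro tendsto_intros lim)
    show "(\<lambda>k. D + inverse (real (Suc k))) \<longlonglongrightarrow> D + 0"
      by (intro tendsto_intros LIMSEQ_inverse_real_of_nat)
    show "\<exists>N. \<forall>k\<ge>N. (norm (u k))\<^sup>2 \<le> D + inverse (real (Suc k))"
      using u_less less_imp_le by blast
  qed
  then have "norm z \<le> norm x" if "x \<in> C" for x
    using order_trans[OF _ D_le[OF that], of "(norm z)\<^sup>2"]
    by (intro power2_le_imp_le[of "norm z" "norm x"]) simp_all
  with \<open>z \<in> C\<close> show ?thesis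
    by (rule that)
qed

text \<open>
  For a nonzero functional, the shortest vector \<open>z\<close> of the hyperplane \<open>f x = 1\<close> is orthogonal to the
  kernel of \<open>f\<close>. As \<open>x - f x z\<close> is in the kernel, \<open>\<langle>x, z\<rangle> = f x \<parallel>z\<parallel>\<^sup>2\<close>, and \<open>z / \<parallel>z\<parallel>\<^sup>2\<close> represents \<open>f\<close>.
\<close>

lemma Riesz_representation:
  assumes lin: "\<And>x y. f (x + y) = f x + f y" "\<And>c x. f (smul c x) = c * f x"
    and bound: "\<And>x. norm (f x) \<le> K * norm x"
  obtains b where "\<And>x. f x = ip x b"
proof (cases "\<forall>x. f x = 0")
  case True
  then show ?thesis
    by (intro that[of 0]) simp
next
  case False
  then obtain v where v: "f v \<noteq> 0"
    by blast
  have bl: "bounded_linear f"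
    by (rule bounded_linear_intro[where K = K])
      (simp_all add: lin scale_of_real_scaleR scaleR_conv_of_real bound mult.commute)
  interpret f: bounded_linear f by (rule bl)
  define C where "C = {x. f x = 1}"
  have "closed C"
    unfolding C_def by (intro closed_Collect_eq continuous_intros linear_continuous_on bl)
  moreover have "convex C"
    unfolding C_def by (auto simp: convex_def f.add f.scaleR simp flip: scaleR_add_left)
  moreover have "smul (1 / f v) v \<in> C"
    using v by (simp add: C_def lin)
  then have "C \<noteq> {}"
    by auto
  ultimately obtain z where "z \<in> C" and "\<And>x. x \<in> C \<Longrightarrow> norm z \<le> norm x"
    by (rule convex_closed_min_norm) auto
  then have z: "f z = 1" and min: "\<And>x. f x = 1 \<Longrightarrow> norm z \<le> norm x"
    by (simp_all add: C_def)
  have orth: "ip w z = 0" if "f w = 0" for w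
  proof (cases "w = 0")
    case False
    define c where "c = ip z w / of_real ((norm w)\<^sup>2)"
    have "f (z - smul c w) = 1"
      by (simp only: f.diff lin(2) z that mult_zero_right diff_zero)
    then have "(norm z)\<^sup>2 \<le> (norm (z - smul c w))\<^sup>2"
      by (intro power_mono min) simp_all
    then have "(norm (ip z w))\<^sup>2 / (norm w)\<^sup>2 \<le> 0"
      unfolding c_def norm_diff_projection[OF False] by simp
    then have "ip z w = 0"
      using False by (simp add: divide_le_0_iff)
    then show ?thesis
      by (subst ip_conj_sym) simp
  qed simp
  have "z \<noteq> 0"
    using z f.zero by auto
  show ?thesis
  proof (rule that[of "(1 / (norm z)\<^sup>2) *\<^sub>R z"])
    fix x
    have "f (x - smul (f x) z) = 0"
      by (simp only: f.diff lin(2) z mult_1_right diff_self)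
    from orth[OF this] have "ip x z = f x * of_real ((norm z)\<^sup>2)"
      by (simp add: ip_diff_left ip_scale_left ip_self)
    then show "f x = ip x ((1 / (norm z)\<^sup>2) *\<^sub>R z)"
      using \<open>z \<noteq> 0\<close> by (simp add: ip_scaleR_right)
  qed
qed

lemma bounded_operatorsD:
  assumes "A \<in> bounded_operators smul"
  shows "bounded_linear A" "A (smul c x) = smul c (A x)"
  using assms module_hom.scale[OF Vector_Spaces.linear.axioms(3)]
  by (auto simp: bounded_operators_def)

text \<open>
  For fixed \<open>y\<close> the functional \<open>\<lambda>x. \<langle>A x, y\<rangle>\<close> is bounded, and its Riesz representative serves as the
  value at \<open>y\<close> of an adjoint. Hence the choice in the definition of the adjoint succeeds.
\<close>

lemma hilbert_adjoint:
  assumes "A \<in> bounded_operators smul"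
  shows "ip (A x) y = ip x (hilbert_adjoint ip A y)"
proof -
  note A = bounded_operatorsD[OF assms]
  interpret A: bounded_linear A by (rule A)
  have "\<exists>b. \<forall>x. ip (A x) y = ip x b" for y
  proof -
    have "norm (ip (A x) y) \<le> (onorm A * norm y) * norm x" for x
    proof -
      have "norm (ip (A x) y) \<le> norm (A x) * norm y"
        by (rule ip_Cauchy_Schwarz)
      also have "\<dots> \<le> (onorm A * norm x) * norm y"
        by (intro mult_right_mono onorm A) simp
      finally show ?thesis
        by (simp add: mult_ac)
    qed
    then show ?thesis
      using Riesz_representation[of "\<lambda>x. ip (A x) y" "onorm A * norm y"]
      by (metis A.add A(2) ip_add_left ip_scale_left)
  qed
  then have "\<exists>B. \<forall>x y. ip (A x) y = ip x (B y)"
    by metis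
  from someI_ex[OF this] show ?thesis
    unfolding hilbert_adjoint_def by blast
qed

text \<open>
  The inequality \<open>\<parallel>T\<^sup>*\<parallel>\<^sup>2 \<le> \<parallel>T T\<^sup>*\<parallel>\<close>, from \<open>\<parallel>S y\<parallel>\<^sup>2 = \<langle>T (S y), y\<rangle>\<close> for an adjoint \<open>S\<close> of \<open>T\<close>. It is
  stated pointwise so that it serves to bound \<open>S\<close> by a bound on \<open>T S\<close> alone.
\<close>

lemma norm_le_of_adjoint_comp_le:
  assumes adj: "\<And>x y. ip (T x) y = ip x (S y)"
    and bound: "\<And>y. norm (T (S y)) \<le> K * norm y"
  shows "norm (S y) \<le> sqrt K * norm y"
proof -
  have "(norm (S y))\<^sup>2 = norm (ip (S y) (S y))"
    by (simp add: ip_self norm_power)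
  also have "\<dots> = norm (ip (T (S y)) y)"
    by (simp add: adj)
  also have "\<dots> \<le> norm (T (S y)) * norm y"
    by (rule ip_Cauchy_Schwarz)
  also have "\<dots> \<le> (K * norm y) * norm y"
    by (intro mult_right_mono bound) simp
  finally have "(norm (S y))\<^sup>2 \<le> K * (norm y)\<^sup>2"
    by (simp add: power2_eq_square mult.assoc)
  then show ?thesis
    using real_sqrt_le_mono by (fastforce simp: real_sqrt_mult)
qed

text \<open>
  The same identity, with one factor \<open>\<parallel>S y\<parallel>\<close> cancelled, shows that a bound for an operator is also
  a bound for its adjoint.
\<close>

lemma norm_adjoint_le:
  assumes adj: "\<And>x y. ip (T x) y = ip x (S y)"
    and bound: "\<And>x. norm (T x) \<le> K * norm x" and "0 \<le> K"
  shows "norm (S y) \<le> K * norm y"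
proof -
  have "(norm (S y))\<^sup>2 = norm (ip (T (S y)) y)"
    by (simp add: adj ip_self norm_power)
  also have "\<dots> \<le> norm (T (S y)) * norm y"
    by (rule ip_Cauchy_Schwarz)
  also have "\<dots> \<le> (K * norm (S y)) * norm y"
    by (intro mult_right_mono bound) simp
  finally have "norm (S y) * norm (S y) \<le> norm (S y) * (K * norm y)"
    by (simp add: power2_eq_square mult_ac)
  then show ?thesis
    using \<open>0 \<le> K\<close> by (cases "S y = 0") (simp_all add: mult_le_cancel_left)
qed

lemma norm_hilbert_adjoint_le:
  assumes "A \<in> bounded_operators smul"
  shows "norm (hilbert_adjoint ip A y) \<le> onorm A * norm y"
  using bounded_operatorsD(1)[OF assms]
  by (intro norm_adjoint_le[OF hilbert_adjoint[OF assms]] onorm onorm_pos_le)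

lemma bounded_linear_hilbert_adjoint:
  assumes "A \<in> bounded_operators smul"
  shows "bounded_linear (hilbert_adjoint ip A)"
proof (rule bounded_linear_intro[where K = "onorm A"])
  show "hilbert_adjoint ip A (x + y) = hilbert_adjoint ip A x + hilbert_adjoint ip A y" for x y
    by (rule ip_eqI) (simp add: ip_add_right flip: hilbert_adjoint[OF assms])
  show "hilbert_adjoint ip A (r *\<^sub>R x) = r *\<^sub>R hilbert_adjoint ip A x" for r x
    by (rule ip_eqI) (simp add: ip_scaleR_right flip: hilbert_adjoint[OF assms])
  show "norm (hilbert_adjoint ip A x) \<le> norm x * onorm A" for x
    using norm_hilbert_adjoint_le[OF assms, of x] by (simp add: mult.commute)
qed

lemma bounded_linear_comp_hilbert_adjoint:
  assumes "A \<in> bounded_operators smul" "B \<in> bounded_operators smul"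
  shows "bounded_linear (A \<circ> hilbert_adjoint ip B)"
  unfolding o_def
  by (rule bounded_linear_compose[OF bounded_operatorsD(1)[OF assms(1)]
        bounded_linear_hilbert_adjoint[OF assms(2)]])

lemma onorm_comp_hilbert_adjoint_le:
  assumes "A \<in> bounded_operators smul"
  shows "onorm (A \<circ> hilbert_adjoint ip A) \<le> (onorm A)\<^sup>2"
proof -
  note A = bounded_operatorsD(1)[OF assms]
  have "onorm (hilbert_adjoint ip A) \<le> onorm A"
    by (rule onorm_bound) (simp_all add: onorm_pos_le A norm_hilbert_adjoint_le assms)
  then have "onorm A * onorm (hilbert_adjoint ip A) \<le> (onorm A)\<^sup>2"
    by (simp add: power2_eq_square mult_left_mono onorm_pos_le A)
  with onorm_compose[OF A bounded_linear_hilbert_adjoint[OF assms]] show ?thesis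
    by linarith
qed

section \<open>The norm of a linear combination of operators\<close>

text \<open>
  The operator \<open>S = \<Sum>\<^sub>j \<alpha>\<^sub>j\<^sup>* A\<^sub>j\<^sup>*\<close> is an adjoint of the linear combination \<open>T\<close>. The triangle
  inequality bounds \<open>T S\<close> by the double sum, say \<open>K\<close>; therefore \<open>S\<close>, and with it \<open>T\<close>, is bounded by \<open>sqrt K\<close>.
\<close>

lemma onorm_sum_squared_le:
  assumes A: "\<And>i. i \<in> I \<Longrightarrow> A i \<in> bounded_operators smul"
  shows "(onorm (\<lambda>x. \<Sum>i\<in>I. smul (\<alpha> i) (A i x)))\<^sup>2
    \<le> (\<Sum>i\<in>I. \<Sum>j\<in>I. norm (\<alpha> i) * norm (\<alpha> j) * onorm (A i \<circ> hilbert_adjoint ip (A j)))"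
    (is "(onorm ?T)\<^sup>2 \<le> ?K")
proof -
  let ?B = "\<lambda>j. hilbert_adjoint ip (A j)"
  define S where "S = (\<lambda>y. \<Sum>j\<in>I. smul (kconj (\<alpha> j)) (?B j y))"
  have comp: "bounded_linear (A i \<circ> ?B j)" if "i \<in> I" "j \<in> I" for i j
    using that A by (intro bounded_linear_comp_hilbert_adjoint)
  have T: "bounded_linear ?T"
    using A
    by (intro bounded_linear_sum bounded_linear_compose[OF bounded_linear_smul] bounded_operatorsD(1))
  have adj: "ip (?T x) y = ip x (S y)" for x y
    unfolding S_def ip_sum_left ip_sum_right
    by (intro sum.cong refl) (simp add: ip_scale_left ip_scale_right hilbert_adjoint A)
  have K: "0 \<le> ?K"
    by (intro sum_nonneg mult_nonneg_nonneg onorm_pos_le comp) auto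
  have TS: "norm (?T (S y)) \<le> ?K * norm y" for y
  proof -
    have "A i (S y) = (\<Sum>j\<in>I. smul (kconj (\<alpha> j)) ((A i \<circ> ?B j) y))" if "i \<in> I" for i
      unfolding S_def using bounded_operatorsD[OF A[OF that]]
      by (simp add: linear_sum[OF bounded_linear.linear])
    then have "?T (S y) = (\<Sum>i\<in>I. \<Sum>j\<in>I. smul (\<alpha> i) (smul (kconj (\<alpha> j)) ((A i \<circ> ?B j) y)))"
      by (simp add: scale_sum_right)
    also have "norm \<dots> \<le> (\<Sum>i\<in>I. \<Sum>j\<in>I. norm (\<alpha> i) * norm (\<alpha> j) * onorm (A i \<circ> ?B j) * norm y)"
    proof (intro sum_norm_le)
      fix i j
      assume "i \<in> I" "j \<in> I"
      from onorm[OF comp[OF this], of y]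
      show "norm (smul (\<alpha> i) (smul (kconj (\<alpha> j)) ((A i \<circ> ?B j) y)))
          \<le> norm (\<alpha> i) * norm (\<alpha> j) * onorm (A i \<circ> ?B j) * norm y"
        by (simp add: norm_smul norm_mult mult.assoc mult_left_mono)
    qed
    finally show ?thesis
      by (simp only: sum_distrib_right)
  qed
  have S: "norm (S y) \<le> sqrt ?K * norm y" for y
    by (rule norm_le_of_adjoint_comp_le[OF adj TS])
  have "ip (S x) y = ip x (?T y)" for x y
    by (metis ip_conj_sym adj)
  from norm_adjoint_le[OF this S] K have "onorm ?T \<le> sqrt ?K"
    by (intro onorm_bound) (simp_all only: real_sqrt_ge_zero)
  then have "(onorm ?T)\<^sup>2 \<le> (sqrt ?K)\<^sup>2"
    by (intro power_mono onorm_pos_le T)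
  with K show ?thesis
    by (simp only: real_sqrt_pow2)
qed

end

section \<open>Hoelder's inequality for finite sums\<close>

lemma max_over_upper: "finite I \<Longrightarrow> i \<in> I \<Longrightarrow> f i \<le> max_over I f"
  by (auto simp: max_over_def)

lemma sum_mult_le_max_over:
  assumes "finite I" "\<And>i. i \<in> I \<Longrightarrow> 0 \<le> g i"
  shows "(\<Sum>i\<in>I. f i * g i) \<le> max_over I f * (\<Sum>i\<in>I. g i)"
  unfolding sum_distrib_left using assms by (intro sum_mono mult_right_mono max_over_upper)

text \<open>
  Dividing \<open>f\<close> and \<open>g\<close> by their \<open>p\<close>- and \<open>q\<close>-norms reduces the claim to norms equal to \<open>1\<close>, where
  Young's inequality can be summed termwise. If one of the norms vanishes, so does every product.
\<close>

lemma Hoelder_inequality_sum: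
  fixes f g :: "'i \<Rightarrow> real"
  assumes pq: "p > 1" "1 / p + 1 / q = 1" and I: "finite I"
    and f: "\<And>i. i \<in> I \<Longrightarrow> 0 \<le> f i" and g: "\<And>i. i \<in> I \<Longrightarrow> 0 \<le> g i"
  shows "(\<Sum>i\<in>I. f i * g i) \<le> (\<Sum>i\<in>I. f i powr p) powr (1 / p) * (\<Sum>i\<in>I. g i powr q) powr (1 / q)"
proof -
  have "0 < 1 / p" "1 / p < 1"
    using pq(1) by simp_all
  with pq(2) have "0 < 1 / q" "1 / q < 1"
    by linarith+
  then have q: "q > 1"
    by (simp add: field_simps split: if_splits)
  define X where "X = (\<Sum>i\<in>I. f i powr p)"
  define Y where "Y = (\<Sum>i\<in>I. g i powr q)"
  show ?thesis
  proof (cases "X = 0 \<or> Y = 0")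
    case True
    then have "\<forall>i\<in>I. f i = 0 \<or> g i = 0"
      using I by (auto simp: X_def Y_def sum_nonneg_eq_0_iff)
    then have "(\<Sum>i\<in>I. f i * g i) = 0"
      by (intro sum.neutral) auto
    then show ?thesis
      by simp
  next
    case False
    then have XY: "X > 0" "Y > 0"
      using sum_nonneg[of I "\<lambda>i. f i powr p"] sum_nonneg[of I "\<lambda>i. g i powr q"]
      by (auto simp: X_def Y_def less_le)
    let ?x = "X powr (1 / p)" and ?y = "Y powr (1 / q)"
    have xy: "?x > 0" "?y > 0" "?x powr p = X" "?y powr q = Y"
      using XY pq q by (simp_all add: powr_powr)
    have "(\<Sum>i\<in>I. (f i / ?x) * (g i / ?y)) \<le> (\<Sum>i\<in>I. (f i / ?x) powr p / p + (g i / ?y) powr q / q)"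
      using f g xy(1,2) by (intro sum_mono Youngs_inequality pq q) auto
    also have "\<dots> = (\<Sum>i\<in>I. f i powr p / X / p + g i powr q / Y / q)"
      using f g xy by (intro sum.cong refl) (simp add: powr_divide)
    also have "\<dots> = X / X / p + Y / Y / q"
      by (simp only: sum.distrib sum_divide_distrib X_def Y_def)
    also have "\<dots> = 1"
      using XY pq by simp
    finally have "(\<Sum>i\<in>I. f i * g i) / (?x * ?y) \<le> 1"
      by (simp add: sum_divide_distrib)
    then show ?thesis
      using xy(1,2) unfolding X_def[symmetric] Y_def[symmetric] by (simp add: divide_le_eq)
  qed
qed

text \<open>
  The two endpoint cases together with the case of finite conjugate exponents, in one
  disjunction, so that the diagonal and the off-diagonal sums can be treated alike.
\<close>

lemma Hoelder_inequality_sum_cases: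
  fixes f g :: "'i \<Rightarrow> real"
  assumes I: "finite I" and f: "\<And>i. i \<in> I \<Longrightarrow> 0 \<le> f i" and g: "\<And>i. i \<in> I \<Longrightarrow> 0 \<le> g i"
    and B: "B = max_over I f * (\<Sum>i\<in>I. g i)
      \<or> (\<exists>p q. p > 1 \<and> 1 / p + 1 / q = 1 \<and>
           B = (\<Sum>i\<in>I. f i powr p) powr (1 / p) * (\<Sum>i\<in>I. g i powr q) powr (1 / q))
      \<or> B = (\<Sum>i\<in>I. f i) * max_over I g"
  shows "(\<Sum>i\<in>I. f i * g i) \<le> B"
  using B
proof (elim disjE exE conjE)
  assume "B = max_over I f * (\<Sum>i\<in>I. g i)"
  then show ?thesis
    using sum_mult_le_max_over[of I g f] I g by simp
next
  assume "B = (\<Sum>i\<in>I. f i) * max_over I g"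
  then show ?thesis
    using sum_mult_le_max_over[of I f g] I f by (simp add: mult.commute)
next
  fix p q :: real
  assume "p > 1" "1 / p + 1 / q = 1"
    "B = (\<Sum>i\<in>I. f i powr p) powr (1 / p) * (\<Sum>i\<in>I. g i powr q) powr (1 / q)"
  then show ?thesis
    using Hoelder_inequality_sum[of p q I f g] I f g by simp
qed

section \<open>Splitting off the diagonal\<close>

lemma finite_off_diag: "finite (off_diag n)"
  by (rule finite_subset[of _ "{1..n} \<times> {1..n}"]) (auto simp: off_diag_def)

lemma sum_square_eq_diag_plus_off_diag:
  fixes h :: "nat \<Rightarrow> nat \<Rightarrow> 'b::comm_monoid_add"
  shows "(\<Sum>i=1..n. \<Sum>j=1..n. h i j) = (\<Sum>i=1..n. h i i) + (\<Sum>(i, j)\<in>off_diag n. h i j)"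
proof -
  let ?D = "(\<lambda>i. (i, i)) ` {1..n}"
  have "{1..n} \<times> {1..n} = ?D \<union> off_diag n" "?D \<inter> off_diag n = {}"
    by (auto simp: off_diag_def)
  then have "(\<Sum>(i, j)\<in>{1..n} \<times> {1..n}. h i j) = (\<Sum>(i, j)\<in>?D. h i j) + (\<Sum>(i, j)\<in>off_diag n. h i j)"
    by (simp add: sum.union_disjoint finite_off_diag)
  moreover have "(\<Sum>(i, j)\<in>?D. h i j) = (\<Sum>i=1..n. h i i)"
    by (subst sum.reindex) (auto simp: inj_on_def)
  ultimately show ?thesis
    by (simp add: sum.cartesian_product)
qed

lemma sum_off_diag_mult:
  fixes a :: "nat \<Rightarrow> real"
  shows "(\<Sum>(i, j)\<in>off_diag n. a i * a j) = (\<Sum>i=1..n. a i)\<^sup>2 - (\<Sum>i=1..n. (a i)\<^sup>2)"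
  using sum_square_eq_diag_plus_off_diag[of "\<lambda>i j. a i * a j" n]
  by (simp add: power2_eq_square sum_product)

section \<open>The nine bounds\<close>

theorem theorem2:
  fixes smul :: "'k::rc_field \<Rightarrow> 'h::banach \<Rightarrow> 'h"
    and ip :: "'h \<Rightarrow> 'h \<Rightarrow> 'k"
    and n :: nat
    and \<alpha> :: "nat \<Rightarrow> 'k"
    and A :: "nat \<Rightarrow> 'h \<Rightarrow> 'h"
    and F G :: real
  assumes H: "hilbert_space smul ip"
    and n: "n \<ge> 1"
    and A: "\<And>i. i \<in> {1..n} \<Longrightarrow> A i \<in> bounded_operators smul"
    and F: "F = max_over {1..n} (\<lambda>i. (norm (\<alpha> i))\<^sup>2) * (\<Sum>i=1..n. (onorm (A i))\<^sup>2)
      \<or> (\<exists>p q. p > 1 \<and> 1 / p + 1 / q = 1 \<and>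
           F = (\<Sum>i=1..n. norm (\<alpha> i) powr (2 * p)) powr (1 / p)
             * (\<Sum>i=1..n. onorm (A i) powr (2 * q)) powr (1 / q))
      \<or> F = (\<Sum>i=1..n. (norm (\<alpha> i))\<^sup>2) * max_over {1..n} (\<lambda>i. (onorm (A i))\<^sup>2)"
    and G: "G = max_over (off_diag n) (\<lambda>(i, j). norm (\<alpha> i) * norm (\<alpha> j))
             * (\<Sum>(i, j)\<in>off_diag n. onorm (A i \<circ> hilbert_adjoint ip (A j)))
      \<or> (\<exists>r s. r > 1 \<and> 1 / r + 1 / s = 1 \<and>
           G = ((\<Sum>i=1..n. norm (\<alpha> i) powr r)\<^sup>2 - (\<Sum>i=1..n. norm (\<alpha> i) powr (2 * r))) powr (1 / r)
             * (\<Sum>(i, j)\<in>off_diag n. onorm (A i \<circ> hilbert_adjoint ip (A j)) powr s) powr (1 / s))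
      \<or> G = ((\<Sum>i=1..n. norm (\<alpha> i))\<^sup>2 - (\<Sum>i=1..n. (norm (\<alpha> i))\<^sup>2))
             * max_over (off_diag n) (\<lambda>(i, j). onorm (A i \<circ> hilbert_adjoint ip (A j)))"
  shows "(onorm (\<lambda>x. \<Sum>i=1..n. smul (\<alpha> i) (A i x)))\<^sup>2 \<le> F + G"
proof -
  interpret hilbert_space smul ip by (rule H)
  define a where "a = (\<lambda>i. norm (\<alpha> i))"
  define b where "b = (\<lambda>i. onorm (A i))"
  define c where "c = (\<lambda>i j. onorm (A i \<circ> hilbert_adjoint ip (A j)))"
  have a: "0 \<le> a i" for i
    by (simp add: a_def)
  have b: "0 \<le> b i" if "i \<in> {1..n}" for i
    unfolding b_def using that A by (intro onorm_pos_le bounded_operatorsD(1))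
  have c: "0 \<le> c i j" if "(i, j) \<in> off_diag n" for i j
    unfolding c_def using that A
    by (intro onorm_pos_le bounded_linear_comp_hilbert_adjoint) (auto simp: off_diag_def)
  have sq_powr: "x\<^sup>2 powr p = x powr (2 * p)" if "0 \<le> x" for x p :: real
    using that by (cases "x = 0") (simp_all add: powr_powr flip: powr_numeral)
  have powr_a: "(\<Sum>i=1..n. (a i)\<^sup>2 powr p) = (\<Sum>i=1..n. a i powr (2 * p))" for p
    by (intro sum.cong refl sq_powr a)
  have powr_b: "(\<Sum>i=1..n. (b i)\<^sup>2 powr q) = (\<Sum>i=1..n. b i powr (2 * q))" for q
    by (intro sum.cong refl sq_powr b)
  have "(\<Sum>i=1..n. (a i)\<^sup>2 * (b i)\<^sup>2) \<le> F"
  proof (rule Hoelder_inequality_sum_cases)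
    show "F = max_over {1..n} (\<lambda>i. (a i)\<^sup>2) * (\<Sum>i=1..n. (b i)\<^sup>2)
      \<or> (\<exists>p q. p > 1 \<and> 1 / p + 1 / q = 1 \<and>
           F = (\<Sum>i=1..n. (a i)\<^sup>2 powr p) powr (1 / p) * (\<Sum>i=1..n. (b i)\<^sup>2 powr q) powr (1 / q))
      \<or> F = (\<Sum>i=1..n. (a i)\<^sup>2) * max_over {1..n} (\<lambda>i. (b i)\<^sup>2)"
      using F unfolding powr_a powr_b by (simp only: a_def b_def)
  qed simp_all
  moreover have "(\<Sum>x\<in>off_diag n. (case x of (i, j) \<Rightarrow> a i * a j) * (case x of (i, j) \<Rightarrow> c i j)) \<le> G"
  proof (rule Hoelder_inequality_sum_cases)
    have powr: "(\<Sum>x\<in>off_diag n. (case x of (i, j) \<Rightarrow> a i * a j) powr r)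
        = (\<Sum>i=1..n. a i powr r)\<^sup>2 - (\<Sum>i=1..n. a i powr (2 * r))" for r
      using sum_off_diag_mult[of "\<lambda>i. a i powr r" n]
      by (simp add: case_prod_unfold powr_mult a power2_eq_square flip: powr_add)
    show "G = max_over (off_diag n) (\<lambda>(i, j). a i * a j) * (\<Sum>(i, j)\<in>off_diag n. c i j)
      \<or> (\<exists>r s. r > 1 \<and> 1 / r + 1 / s = 1 \<and>
           G = (\<Sum>x\<in>off_diag n. (case x of (i, j) \<Rightarrow> a i * a j) powr r) powr (1 / r)
             * (\<Sum>x\<in>off_diag n. (case x of (i, j) \<Rightarrow> c i j) powr s) powr (1 / s))
      \<or> G = (\<Sum>(i, j)\<in>off_diag n. a i * a j) * max_over (off_diag n) (\<lambda>(i, j). c i j)"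
      using G unfolding powr sum_off_diag_mult by (simp add: a_def c_def case_prod_unfold)
  qed (use a c finite_off_diag in auto)
  moreover have "(onorm (\<lambda>x. \<Sum>i=1..n. smul (\<alpha> i) (A i x)))\<^sup>2
      \<le> (\<Sum>i=1..n. a i * a i * c i i) + (\<Sum>(i, j)\<in>off_diag n. a i * a j * c i j)"
    using onorm_sum_squared_le[of "{1..n}" A \<alpha>] A
    unfolding sum_square_eq_diag_plus_off_diag by (simp add: a_def c_def)
  moreover have "(\<Sum>i=1..n. a i * a i * c i i) \<le> (\<Sum>i=1..n. (a i)\<^sup>2 * (b i)\<^sup>2)"
    unfolding b_def c_def power2_eq_square[of "a _"]
    by (intro sum_mono mult_left_mono onorm_comp_hilbert_adjoint_le A) (simp_all add: a)
  ultimately show ?thesis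
    by (simp add: case_prod_unfold)
qed

end
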